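(* Consider the private information model with $\sigma$-correlated preferences, and let $L^\Gamma=\sum_{i=1}^Ns_i^\Gamma$ be the total equilibrium consumption of the $N$ consumers under behavior model $\Gamma\in\{S,U,W\}$. For a large number of consumers $N$, we have: 1. $\mathrm{Var}(L^\Gamma/N)\approx\sigma(N\lambda^\Gamma\sigma+2\alpha)^{-2}$, where $\lambda^S=\gamma/N$, $\lambda^U=2\gamma/N$, $\lambda^W=2\kappa/N$. 2. $$\frac{\partial\,\mathrm{Var}(L^\Gamma/N)}{\partial\sigma}=\frac{2\alpha-N\lambda^\Gamma\sigma}{(N\lambda^\Gamma\sigma+2\alpha)^3}.$$ 3. If $\sigma=0$, then the variance of normalized demand $L^\Gamma/N$ is the same for all behavior models $\Gamma\in\{S,U,W\}$. 4. If $\sigma\in(0,1]$, then $1<\mathrm{Var}(L^S/N)/\mathrm{Var}(L^U/N)<4$. 5. If $\sigma\in(0,1]$, then $\mathrm{Var}(L^U/N)/\mathrm{Var}(L^W/N)=\dfrac{(\alpha+\kappa\sigma)^2}{(\alpha+\gamma\sigma)^2}$, which is less than $1$ for $\gamma>\kappa$.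
   Context: There are $N$ consumers. Constants $\gamma,\alpha,\kappa>0$, $\bar g>0$, $\bar\omega\in\mathbb{R}$, $\sigma\in[0,1]$. The preference vector $(g_1,\dots,g_N)$ is normal with mean $\bar g\mathbf{1}$ and is $\sigma$-correlated: covariance matrix with diagonal entries $1$ and off-diagonal entries $\sigma$. Put $\lambda^S=\mu^S=\tau^S=\gamma/N$; $\lambda^U=2\gamma/N$, $\mu^U=\tau^U=\gamma/N$; $\lambda^W=2\kappa/N$, $\mu^W=0$, $\tau^W=\kappa/N$; $\rho^\Gamma=(2(\tau^\Gamma+\alpha))^{-1}$; $a^\Gamma=\rho^\Gamma(1+\lambda^\Gamma\rho^\Gamma\sigma(N-1))^{-1}$; $b^\Gamma=\rho^\Gamma(1+\lambda^\Gamma\rho^\Gamma(N-1))^{-1}$. In the private information model (consumer $i$ knows only $g_i$) the Bayesian Nash equilibrium consumption of consumer $i$ under behavior model $\Gamma$ (selfish $S$, altruistic $U$, welfare-maximizing $W$) is $s_i^\Gamma=a^\Gamma(g_i-\bar g)+b^\Gamma(\bar g-\bar\omega\mu^\Gamma)$, and $\mathrm{Var}(L^\Gamma/N)=\frac{1+(N-1)\sigma}{N}(a^\Gamma)^2$. The relations "for large $N$" are obtained by using the large-$N$ approximation $a^\Gamma\approx(N\lambda^\Gamma\sigma+2\alpha)^{-1}$. *)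

theory Defs
  imports "HOL-Probability.Probability"
begin

datatype behavior = Selfish | Altruistic | Welfare

fun lam :: "real \<Rightarrow> real \<Rightarrow> behavior \<Rightarrow> nat \<Rightarrow> real" where
  "lam \<gamma> \<kappa> Selfish N = \<gamma> / real N"
| "lam \<gamma> \<kappa> Altruistic N = 2 * \<gamma> / real N"
| "lam \<gamma> \<kappa> Welfare N = 2 * \<kappa> / real N"

fun mu :: "real \<Rightarrow> behavior \<Rightarrow> nat \<Rightarrow> real" where
  "mu \<gamma> Selfish N = \<gamma> / real N"
| "mu \<gamma> Altruistic N = \<gamma> / real N"
| "mu \<gamma> Welfare N = 0"

fun tau :: "real \<Rightarrow> real \<Rightarrow> behavior \<Rightarrow> nat \<Rightarrow> real" where
  "tau \<gamma> \<kappa> Selfish N = \<gamma> / real N"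
| "tau \<gamma> \<kappa> Altruistic N = \<gamma> / real N"
| "tau \<gamma> \<kappa> Welfare N = \<kappa> / real N"

definition rho :: "real \<Rightarrow> real \<Rightarrow> real \<Rightarrow> behavior \<Rightarrow> nat \<Rightarrow> real" where
  "rho \<gamma> \<alpha> \<kappa> \<Gamma> N = inverse (2 * (tau \<gamma> \<kappa> \<Gamma> N + \<alpha>))"

definition a_coeff :: "real \<Rightarrow> real \<Rightarrow> real \<Rightarrow> behavior \<Rightarrow> nat \<Rightarrow> real \<Rightarrow> real" where
  "a_coeff \<gamma> \<alpha> \<kappa> \<Gamma> N \<sigma> =
     rho \<gamma> \<alpha> \<kappa> \<Gamma> N * inverse (1 + lam \<gamma> \<kappa> \<Gamma> N * rho \<gamma> \<alpha> \<kappa> \<Gamma> N * \<sigma> * (real N - 1))"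

definition b_coeff :: "real \<Rightarrow> real \<Rightarrow> real \<Rightarrow> behavior \<Rightarrow> nat \<Rightarrow> real" where
  "b_coeff \<gamma> \<alpha> \<kappa> \<Gamma> N =
     rho \<gamma> \<alpha> \<kappa> \<Gamma> N * inverse (1 + lam \<gamma> \<kappa> \<Gamma> N * rho \<gamma> \<alpha> \<kappa> \<Gamma> N * (real N - 1))"

text \<open>Bayesian Nash equilibrium strategy of the private information model: the consumption
  of a consumer as a function of the only thing this consumer knows, the own preference \<open>x\<close>.\<close>

definition consumption ::
  "real \<Rightarrow> real \<Rightarrow> real \<Rightarrow> real \<Rightarrow> real \<Rightarrow> behavior \<Rightarrow> nat \<Rightarrow> real \<Rightarrow> real \<Rightarrow> real" where
  "consumption \<gamma> \<alpha> \<kappa> gbar \<omega>bar \<Gamma> N \<sigma> x =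
     a_coeff \<gamma> \<alpha> \<kappa> \<Gamma> N \<sigma> * (x - gbar) + b_coeff \<gamma> \<alpha> \<kappa> \<Gamma> N * (gbar - \<omega>bar * mu \<gamma> \<Gamma> N)"

definition total_consumption ::
  "real \<Rightarrow> real \<Rightarrow> real \<Rightarrow> real \<Rightarrow> real \<Rightarrow> behavior \<Rightarrow> nat \<Rightarrow> real \<Rightarrow> (nat \<Rightarrow> 'a \<Rightarrow> real) \<Rightarrow> 'a \<Rightarrow> real" where
  "total_consumption \<gamma> \<alpha> \<kappa> gbar \<omega>bar \<Gamma> N \<sigma> g w =
     (\<Sum>i=1..N. consumption \<gamma> \<alpha> \<kappa> gbar \<omega>bar \<Gamma> N \<sigma> (g i w))"

text \<open>Univariate normal laws include the degenerate ones (point masses): they are needed for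
  the trivial linear combination below and for perfectly correlated preferences.\<close>

definition normal_rv :: "'a measure \<Rightarrow> ('a \<Rightarrow> real) \<Rightarrow> bool" where
  "normal_rv M X \<longleftrightarrow> X \<in> borel_measurable M \<and>
     (\<exists>m. (AE w in M. X w = m) \<or> (\<exists>s>0. distributed M lborel X (normal_density m s)))"

definition jointly_normal :: "'a measure \<Rightarrow> 'i set \<Rightarrow> ('i \<Rightarrow> 'a \<Rightarrow> real) \<Rightarrow> bool" where
  "jointly_normal M I X \<longleftrightarrow> (\<forall>c. normal_rv M (\<lambda>w. \<Sum>i\<in>I. c i * X i w))"

definition covariance :: "'a measure \<Rightarrow> ('a \<Rightarrow> real) \<Rightarrow> ('a \<Rightarrow> real) \<Rightarrow> real" where
  "covariance M X Y =
     prob_space.expectation M (\<lambda>w. (X w - prob_space.expectation M X) * (Y w - prob_space.expectation M Y))"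

definition correlated_preferences ::
  "'a measure \<Rightarrow> nat \<Rightarrow> real \<Rightarrow> real \<Rightarrow> (nat \<Rightarrow> 'a \<Rightarrow> real) \<Rightarrow> bool" where
  "correlated_preferences M N gbar \<sigma> g \<longleftrightarrow>
     prob_space M \<and> jointly_normal M {1..N} g \<and>
     (\<forall>i\<in>{1..N}. prob_space.expectation M (g i) = gbar) \<and>
     (\<forall>i\<in>{1..N}. \<forall>j\<in>{1..N}. covariance M (g i) (g j) = (if i = j then 1 else \<sigma>))"

text \<open>The exact variance at finite \<open>N\<close>. Relations \<open>for large N\<close> are limits of it as \<open>N\<close> tends to
  infinity; \<open>real N * lam \<gamma> \<kappa> \<Gamma> N\<close> is independent of \<open>N \<ge> 1\<close>. Without preference correlation the
  variances of all models vanish in the limit, so there they are compared by their ratio.\<close>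

definition var_demand ::
  "real \<Rightarrow> real \<Rightarrow> real \<Rightarrow> real \<Rightarrow> real \<Rightarrow> 'a measure \<Rightarrow> (nat \<Rightarrow> 'a \<Rightarrow> real) \<Rightarrow> behavior \<Rightarrow> nat \<Rightarrow> real \<Rightarrow> real" where
  "var_demand \<gamma> \<alpha> \<kappa> gbar \<omega>bar M g \<Gamma> N \<sigma> =
     prob_space.variance M (\<lambda>w. total_consumption \<gamma> \<alpha> \<kappa> gbar \<omega>bar \<Gamma> N \<sigma> g w / real N)"

end

theory Submission
  imports Defs
begin

text \<open>With \<open>h = 1 / N\<close>, \<open>c = N * lam\<close> and \<open>d = N * tau\<close>, the last two being independent of \<open>N\<close>,
  the exact variance is a rational function of \<open>h\<close> and \<open>\<sigma>\<close> that is regular at \<open>h = 0\<close>. Its value there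
  is the large-\<open>N\<close> approximation, and all claims follow by letting \<open>h\<close> tend to \<open>0\<close>.\<close>

section \<open>Moments of the total consumption\<close>

text \<open>Expanding (|x| - |y|)^2 >= 0 shows that x^2 + y^2 dominates |x y|.\<close>

lemma integrable_mult_if_square_integrable:
  fixes X Y :: "'a \<Rightarrow> real"
  assumes [measurable]: "X \<in> borel_measurable M" "Y \<in> borel_measurable M"
    and "integrable M (\<lambda>w. X w * X w)" "integrable M (\<lambda>w. Y w * Y w)"
  shows "integrable M (\<lambda>w. X w * Y w)"
proof (rule Bochner_Integration.integrable_bound)
  show "integrable M (\<lambda>w. X w * X w + Y w * Y w)"
    using assms by simp
  have "\<bar>x * y\<bar> \<le> x * x + y * y" for x y :: real
  proof -
    have "0 \<le> (\<bar>x\<bar> - \<bar>y\<bar>)\<^sup>2" by simp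
    then have "2 * \<bar>x * y\<bar> \<le> x * x + y * y"
      by (simp add: power2_eq_square algebra_simps abs_mult)
    then show ?thesis by linarith
  qed
  then show "AE w in M. norm (X w * Y w) \<le> norm (X w * X w + Y w * Y w)"
    by (intro AE_I2) (simp add: order_trans[OF _ abs_ge_self])
qed simp

text \<open>Taking the \<open>i\<close>-th unit vector as coefficients turns the linear combination
  into \<open>X i\<close> itself.\<close>

lemma jointly_normal_measurable:
  assumes "jointly_normal M I X" "finite I" "i \<in> I"
  shows "X i \<in> borel_measurable M"
proof -
  have "normal_rv M (\<lambda>w. \<Sum>j\<in>I. (if j = i then 1 else 0) * X j w)"
    using assms(1) unfolding jointly_normal_def by (rule spec)
  moreover have "(\<Sum>j\<in>I. (if j = i then 1 else 0) * X j w) = X i w" for w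
    using assms(2,3) by (subst sum.remove) (auto intro!: sum.neutral)
  ultimately show ?thesis by (simp add: normal_rv_def)
qed

text \<open>Normalized demand is affine in the sum of the centred preferences. Its variance is
  therefore (a/N)^2 times the sum of all entries of the covariance matrix, N of them equal to 1 and
  N(N - 1) equal to \<sigma>.\<close>

lemma var_demand_eq:
  assumes prefs: "correlated_preferences M N gbar \<sigma> g" and N: "N \<ge> 1" and "gbar \<noteq> 0"
  shows "var_demand \<gamma> \<alpha> \<kappa> gbar \<omega>bar M g \<Gamma> N \<sigma> =
    (1 + (real N - 1) * \<sigma>) / real N * (a_coeff \<gamma> \<alpha> \<kappa> \<Gamma> N \<sigma>)\<^sup>2"
proof -
  interpret prob_space M
    using prefs by (simp add: correlated_preferences_def)
  define a b where "a = a_coeff \<gamma> \<alpha> \<kappa> \<Gamma> N \<sigma>"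
    and "b = b_coeff \<gamma> \<alpha> \<kappa> \<Gamma> N * (gbar - \<omega>bar * mu \<gamma> \<Gamma> N)"
  define X where "X i w = g i w - gbar" for i w
  have [measurable]: "g i \<in> borel_measurable M" if "i \<in> {1..N}" for i
    using prefs jointly_normal_measurable[OF _ _ that] by (auto simp: correlated_preferences_def)
  have mean: "expectation (g i) = gbar" if "i \<in> {1..N}" for i
    using prefs that by (simp add: correlated_preferences_def)
  have cov: "expectation (\<lambda>w. X i w * X j w) = (if i = j then 1 else \<sigma>)"
    if "i \<in> {1..N}" "j \<in> {1..N}" for i j
    using prefs that mean by (simp add: correlated_preferences_def covariance_def X_def)
  \<comment> \<open>The integral of a non-integrable function is \<open>0\<close>, so nonzero moments give integrability.\<close>
  have int_g: "integrable M (g i)" if "i \<in> {1..N}" for i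
    using mean[OF that] \<open>gbar \<noteq> 0\<close> not_integrable_integral_eq by metis
  have int_square: "integrable M (\<lambda>w. X i w * X i w)" if "i \<in> {1..N}" for i
    using cov[OF that that] not_integrable_integral_eq by fastforce
  have X_measurable: "X i \<in> borel_measurable M" if "i \<in> {1..N}" for i
    using that unfolding X_def by measurable
  \<comment> \<open>The covariance \<sigma> of two distinct preferences may be 0, so integrability
    of mixed products is derived from that of the squares, whose mean is 1.\<close>
  have int_prod: "integrable M (\<lambda>w. X i w * X j w)" if "i \<in> {1..N}" "j \<in> {1..N}" for i j
    using that
    by (auto intro: integrable_mult_if_square_integrable[OF X_measurable X_measurable int_square int_square])
  have int_X: "integrable M (X i)" and mean_X: "expectation (X i) = 0" if "i \<in> {1..N}" for i
    using that int_g mean unfolding X_def by (simp_all add: prob_space)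
  have demand: "total_consumption \<gamma> \<alpha> \<kappa> gbar \<omega>bar \<Gamma> N \<sigma> g w / real N
      = a / real N * (\<Sum>i=1..N. X i w) + b" for w
    using N by (simp add: total_consumption_def consumption_def a_def b_def X_def
        sum.distrib sum_distrib_left[symmetric] add_divide_distrib)
  have "integrable M (\<lambda>w. a / real N * (\<Sum>i=1..N. X i w))"
    using int_X by (intro integrable_mult_right Bochner_Integration.integrable_sum)
  then have "expectation (\<lambda>w. a / real N * (\<Sum>i=1..N. X i w) + b) =
      a / real N * expectation (\<lambda>w. \<Sum>i=1..N. X i w) + b"
    by (subst Bochner_Integration.integral_add) (simp_all add: prob_space)
  also have "expectation (\<lambda>w. \<Sum>i=1..N. X i w) = (\<Sum>i=1..N. expectation (X i))"
    using int_X by (rule Bochner_Integration.integral_sum)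
  also have "(\<Sum>i=1..N. expectation (X i)) = 0"
    using mean_X by (rule sum.neutral[OF ballI])
  finally have "expectation (\<lambda>w. a / real N * (\<Sum>i=1..N. X i w) + b) = b"
    by simp
  \<comment> \<open>Since the mean is \<open>b\<close>, subtracting it leaves the second moment of
    the random part.\<close>
  then have "var_demand \<gamma> \<alpha> \<kappa> gbar \<omega>bar M g \<Gamma> N \<sigma>
      = expectation (\<lambda>w. (a / real N * (\<Sum>i=1..N. X i w))\<^sup>2)"
    by (simp add: var_demand_def demand)
  also have "\<dots> = expectation (\<lambda>w. (a / real N)\<^sup>2 * (\<Sum>i=1..N. \<Sum>j=1..N. X i w * X j w))"
    by (simp only: power_mult_distrib power2_eq_square[of "sum f A" for f A] sum_product)
  also have "\<dots> = (a / real N)\<^sup>2 * expectation (\<lambda>w. \<Sum>i=1..N. \<Sum>j=1..N. X i w * X j w)"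
    by simp
  also have "expectation (\<lambda>w. \<Sum>i=1..N. \<Sum>j=1..N. X i w * X j w) =
      (\<Sum>i=1..N. expectation (\<lambda>w. \<Sum>j=1..N. X i w * X j w))"
    by (intro Bochner_Integration.integral_sum Bochner_Integration.integrable_sum int_prod)
  also have "\<dots> = (\<Sum>i=1..N. \<Sum>j=1..N. expectation (\<lambda>w. X i w * X j w))"
    by (intro sum.cong refl Bochner_Integration.integral_sum int_prod)
  also have "\<dots> = (\<Sum>i=1..N. \<Sum>j=1..N. if i = j then 1 else \<sigma>)"
    by (intro sum.cong refl cov)
  also have "(\<Sum>i=1..N. \<Sum>j=1..N. if i = j then 1 else \<sigma>) = real N * (1 + (real N - 1) * \<sigma>)"
  proof -
    have "(\<Sum>j=1..N. if i = j then 1 else \<sigma>) = 1 + (real N - 1) * \<sigma>" if "i \<in> {1..N}" for i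
      using that N by (subst sum.remove[of _ i]) (auto simp: of_nat_diff)
    then show ?thesis by simp
  qed
  also have "(a / real N)\<^sup>2 * (real N * (1 + (real N - 1) * \<sigma>)) = (1 + (real N - 1) * \<sigma>) / real N * a\<^sup>2"
    using N by (simp add: power2_eq_square)
  finally show ?thesis
    unfolding a_def .
qed

section \<open>The variance as a rational function of 1/N\<close>

text \<open>The value at N = 1 serves as a name for the constant product of N and
  \<open>lam\<close>; the same is done for \<open>tau\<close>.\<close>

lemma lam_scaled: "N \<ge> 1 \<Longrightarrow> real N * lam \<gamma> \<kappa> \<Gamma> N = lam \<gamma> \<kappa> \<Gamma> 1"
  by (cases \<Gamma>) auto

lemma tau_scaled: "N \<ge> 1 \<Longrightarrow> tau \<gamma> \<kappa> \<Gamma> N = tau \<gamma> \<kappa> \<Gamma> 1 / real N"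
  by (cases \<Gamma>) auto

text \<open>The reciprocal of \<open>a_coeff\<close> with 1/N replaced by a real variable
  \<open>h\<close>, so that \<open>h = 0\<close> can be substituted although no N corresponds to
  it.\<close>

definition inv_a :: "real \<Rightarrow> real \<Rightarrow> real \<Rightarrow> behavior \<Rightarrow> real \<Rightarrow> real \<Rightarrow> real" where
  "inv_a \<gamma> \<alpha> \<kappa> \<Gamma> h \<sigma> =
     2 * \<alpha> + 2 * tau \<gamma> \<kappa> \<Gamma> 1 * h + lam \<gamma> \<kappa> \<Gamma> 1 * \<sigma> * (1 - h)"

lemma inv_a_0: "inv_a \<gamma> \<alpha> \<kappa> \<Gamma> 0 \<sigma> = lam \<gamma> \<kappa> \<Gamma> 1 * \<sigma> + 2 * \<alpha>"
  by (simp add: inv_a_def)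

text \<open>The summand 2\<alpha> is positive and the others are nonnegative. The range of
  \<open>h\<close> contains 1/N for every N \<ge> 1 and also the limit point 0, so denominators
  vanish neither at finite N nor in the limit.\<close>

lemma inv_a_pos:
  assumes "\<gamma> > 0" "\<alpha> > 0" "\<kappa> > 0" "0 \<le> h" "h \<le> 1" "0 \<le> \<sigma>"
  shows "inv_a \<gamma> \<alpha> \<kappa> \<Gamma> h \<sigma> > 0"
proof -
  have "0 \<le> tau \<gamma> \<kappa> \<Gamma> 1" "0 \<le> lam \<gamma> \<kappa> \<Gamma> 1"
    using assms by (cases \<Gamma>; simp)+
  then have "0 \<le> 2 * tau \<gamma> \<kappa> \<Gamma> 1 * h" "0 \<le> lam \<gamma> \<kappa> \<Gamma> 1 * \<sigma> * (1 - h)"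
    using assms by simp_all
  then show ?thesis
    using assms unfolding inv_a_def by linarith
qed

text \<open>The product of the two inverses is the inverse of a product, in which
  1/\<open>rho\<close> cancels the factor \<open>rho\<close> of the correlation term. Then
  \<open>lam\<close> times N - 1 becomes c(1 - h) and \<open>tau\<close> becomes d h, for h =
  1/N.\<close>

lemma a_coeff_eq:
  assumes "\<gamma> > 0" "\<alpha> > 0" "\<kappa> > 0" "N \<ge> 1"
  shows "a_coeff \<gamma> \<alpha> \<kappa> \<Gamma> N \<sigma> = inverse (inv_a \<gamma> \<alpha> \<kappa> \<Gamma> (1 / real N) \<sigma>)"
proof -
  define t where "t = tau \<gamma> \<kappa> \<Gamma> N + \<alpha>"
  have "tau \<gamma> \<kappa> \<Gamma> N \<ge> 0"
    using assms by (cases \<Gamma>) auto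
  then have "t > 0"
    using assms by (simp add: t_def)
  then have "2 * t * (1 + lam \<gamma> \<kappa> \<Gamma> N * inverse (2 * t) * \<sigma> * (real N - 1)) =
      2 * t + lam \<gamma> \<kappa> \<Gamma> N * \<sigma> * (real N - 1)"
    by (simp add: field_simps)
  then have "a_coeff \<gamma> \<alpha> \<kappa> \<Gamma> N \<sigma> = inverse (2 * t + lam \<gamma> \<kappa> \<Gamma> N * \<sigma> * (real N - 1))"
    unfolding a_coeff_def rho_def t_def[symmetric] by (metis inverse_mult_distrib)
  also have "2 * t + lam \<gamma> \<kappa> \<Gamma> N * \<sigma> * (real N - 1) = inv_a \<gamma> \<alpha> \<kappa> \<Gamma> (1 / real N) \<sigma>"
    using assms lam_scaled[of N \<gamma> \<kappa> \<Gamma>, symmetric] tau_scaled[of N \<gamma> \<kappa> \<Gamma>]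
    by (simp add: inv_a_def t_def field_simps)
  finally show ?thesis .
qed

text \<open>At h = 1/N the numerator is (1 + (N - 1)\<sigma>)/N, the mean entry of the covariance
  matrix; at h = 0 it is \<sigma>.\<close>

definition demand_variance :: "real \<Rightarrow> real \<Rightarrow> real \<Rightarrow> behavior \<Rightarrow> real \<Rightarrow> real \<Rightarrow> real" where
  "demand_variance \<gamma> \<alpha> \<kappa> \<Gamma> h \<sigma> = (h + (1 - h) * \<sigma>) / (inv_a \<gamma> \<alpha> \<kappa> \<Gamma> h \<sigma>)\<^sup>2"

lemma var_demand_eq_demand_variance:
  assumes "\<gamma> > 0" "\<alpha> > 0" "\<kappa> > 0" "gbar \<noteq> 0" "N \<ge> 1"
    and "correlated_preferences M N gbar \<sigma> g"
  shows "var_demand \<gamma> \<alpha> \<kappa> gbar \<omega>bar M g \<Gamma> N \<sigma> = demand_variance \<gamma> \<alpha> \<kappa> \<Gamma> (1 / real N) \<sigma>"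
proof -
  have "(1 + (real N - 1) * \<sigma>) / real N = 1 / real N + (1 - 1 / real N) * \<sigma>"
    using assms by (simp add: field_simps)
  then show ?thesis
    using assms by (simp add: var_demand_eq a_coeff_eq demand_variance_def power_inverse
        divide_inverse)
qed

section \<open>Limits of the variance, its derivative and its ratios\<close>

text \<open>Continuity in \<open>h\<close> at 0, where the denominator is positive.\<close>

lemma demand_variance_tendsto:
  assumes "\<gamma> > 0" "\<alpha> > 0" "\<kappa> > 0" "0 \<le> \<sigma>"
  shows "(\<lambda>N. demand_variance \<gamma> \<alpha> \<kappa> \<Gamma> (1 / real N) \<sigma>)
    \<longlonglongrightarrow> \<sigma> / (lam \<gamma> \<kappa> \<Gamma> 1 * \<sigma> + 2 * \<alpha>)\<^sup>2"
proof -
  have "(\<lambda>N. demand_variance \<gamma> \<alpha> \<kappa> \<Gamma> (1 / real N) \<sigma>) \<longlonglongrightarrow> demand_variance \<gamma> \<alpha> \<kappa> \<Gamma> 0 \<sigma>"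
    using inv_a_pos[OF assms(1-3), of 0 \<sigma> \<Gamma>] assms unfolding demand_variance_def inv_a_def
    by (intro tendsto_intros lim_1_over_n) auto
  then show ?thesis by (simp add: demand_variance_def inv_a_0)
qed

text \<open>The quotient rule in \<sigma>, after cancelling one factor \<open>inv_a\<close>. At h =
  0 the numerator is (c \<sigma> + 2\<alpha>) - 2 c \<sigma> = 2\<alpha> - c \<sigma>.\<close>

definition demand_variance_deriv :: "real \<Rightarrow> real \<Rightarrow> real \<Rightarrow> behavior \<Rightarrow> real \<Rightarrow> real \<Rightarrow> real" where
  "demand_variance_deriv \<gamma> \<alpha> \<kappa> \<Gamma> h \<sigma> =
     (1 - h) * (inv_a \<gamma> \<alpha> \<kappa> \<Gamma> h \<sigma> - 2 * lam \<gamma> \<kappa> \<Gamma> 1 * (h + (1 - h) * \<sigma>)) /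
     (inv_a \<gamma> \<alpha> \<kappa> \<Gamma> h \<sigma>) ^ 3"

text \<open>Derivatives within a set cover the one-sided ones at \<sigma> = 0 and \<sigma> = 1.
  Allowing h = 0 treats the exact variance and its approximation at once.\<close>

lemma demand_variance_has_derivative:
  assumes "\<gamma> > 0" "\<alpha> > 0" "\<kappa> > 0" "0 \<le> h" "h \<le> 1" "0 \<le> \<sigma>"
  shows "(demand_variance \<gamma> \<alpha> \<kappa> \<Gamma> h has_real_derivative demand_variance_deriv \<gamma> \<alpha> \<kappa> \<Gamma> h \<sigma>)
    (at \<sigma> within S)"
proof -
  let ?q = "inv_a \<gamma> \<alpha> \<kappa> \<Gamma> h" and ?c = "lam \<gamma> \<kappa> \<Gamma> 1"
  have [derivative_intros]: "(?q has_real_derivative ?c * (1 - h)) (at \<sigma> within S)"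
    unfolding inv_a_def by (auto intro!: derivative_eq_intros)
  have q: "?q \<sigma> \<noteq> 0"
    using inv_a_pos[OF assms, of \<Gamma>] by simp
  have "((\<lambda>s. (h + (1 - h) * s) / (?q s)\<^sup>2) has_real_derivative
      ((1 - h) * (?q \<sigma>)\<^sup>2 - (h + (1 - h) * \<sigma>) * (2 * ?q \<sigma> * (?c * (1 - h)))) /
      ((?q \<sigma>)\<^sup>2 * (?q \<sigma>)\<^sup>2)) (at \<sigma> within S)"
    using q by (auto intro!: derivative_eq_intros)
  \<comment> \<open>One factor of the denominator's base is split off above and below, to be
    cancelled next.\<close>
  also have "((1 - h) * (?q \<sigma>)\<^sup>2 - (h + (1 - h) * \<sigma>) * (2 * ?q \<sigma> * (?c * (1 - h)))) /
      ((?q \<sigma>)\<^sup>2 * (?q \<sigma>)\<^sup>2) =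
      ?q \<sigma> * ((1 - h) * (?q \<sigma> - 2 * ?c * (h + (1 - h) * \<sigma>))) / (?q \<sigma> * (?q \<sigma>) ^ 3)"
    by (rule arg_cong2[where f = "(/)"]) (simp_all add: power2_eq_square power3_eq_cube algebra_simps)
  also have "\<dots> = demand_variance_deriv \<gamma> \<alpha> \<kappa> \<Gamma> h \<sigma>"
    unfolding demand_variance_deriv_def using q by (rule mult_divide_mult_cancel_left)
  finally show ?thesis
    by (simp add: demand_variance_def[abs_def])
qed

lemma demand_variance_deriv_tendsto:
  assumes "\<gamma> > 0" "\<alpha> > 0" "\<kappa> > 0" "0 \<le> \<sigma>"
  shows "(\<lambda>N. demand_variance_deriv \<gamma> \<alpha> \<kappa> \<Gamma> (1 / real N) \<sigma>)
    \<longlonglongrightarrow> (2 * \<alpha> - lam \<gamma> \<kappa> \<Gamma> 1 * \<sigma>) / (lam \<gamma> \<kappa> \<Gamma> 1 * \<sigma> + 2 * \<alpha>) ^ 3"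
proof -
  have "(\<lambda>N. demand_variance_deriv \<gamma> \<alpha> \<kappa> \<Gamma> (1 / real N) \<sigma>)
      \<longlonglongrightarrow> demand_variance_deriv \<gamma> \<alpha> \<kappa> \<Gamma> 0 \<sigma>"
    using inv_a_pos[OF assms(1-3), of 0 \<sigma> \<Gamma>] assms unfolding demand_variance_deriv_def inv_a_def
    by (intro tendsto_intros lim_1_over_n) auto
  then show ?thesis by (simp add: demand_variance_deriv_def inv_a_0 mult.commute)
qed

text \<open>The numerator of the variance does not depend on the behavior model and cancels in ratios.
  Hence the limit of the ratio exists also for \<open>\<sigma> = 0\<close>, where both variances tend to \<open>0\<close>.\<close>

lemma demand_variance_ratio_tendsto:
  assumes "\<gamma> > 0" "\<alpha> > 0" "\<kappa> > 0" "0 \<le> \<sigma>" "\<sigma> \<le> 1"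
  shows "(\<lambda>N. demand_variance \<gamma> \<alpha> \<kappa> \<Gamma> (1 / real N) \<sigma> / demand_variance \<gamma> \<alpha> \<kappa> \<Gamma>' (1 / real N) \<sigma>)
    \<longlonglongrightarrow> ((lam \<gamma> \<kappa> \<Gamma>' 1 * \<sigma> + 2 * \<alpha>) / (lam \<gamma> \<kappa> \<Gamma> 1 * \<sigma> + 2 * \<alpha>))\<^sup>2"
proof (rule Lim_transform_eventually)
  have "(\<lambda>N. (inv_a \<gamma> \<alpha> \<kappa> \<Gamma>' (1 / real N) \<sigma> / inv_a \<gamma> \<alpha> \<kappa> \<Gamma> (1 / real N) \<sigma>)\<^sup>2)
      \<longlonglongrightarrow> (inv_a \<gamma> \<alpha> \<kappa> \<Gamma>' 0 \<sigma> / inv_a \<gamma> \<alpha> \<kappa> \<Gamma> 0 \<sigma>)\<^sup>2"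
    using inv_a_pos[OF assms(1-3), of 0 \<sigma> \<Gamma>] assms unfolding inv_a_def
    by (intro tendsto_intros lim_1_over_n) auto
  then show "(\<lambda>N. (inv_a \<gamma> \<alpha> \<kappa> \<Gamma>' (1 / real N) \<sigma> / inv_a \<gamma> \<alpha> \<kappa> \<Gamma> (1 / real N) \<sigma>)\<^sup>2)
      \<longlonglongrightarrow> ((lam \<gamma> \<kappa> \<Gamma>' 1 * \<sigma> + 2 * \<alpha>) / (lam \<gamma> \<kappa> \<Gamma> 1 * \<sigma> + 2 * \<alpha>))\<^sup>2"
    by (simp only: inv_a_0)
  show "\<forall>\<^sub>F N in sequentially.
      (inv_a \<gamma> \<alpha> \<kappa> \<Gamma>' (1 / real N) \<sigma> / inv_a \<gamma> \<alpha> \<kappa> \<Gamma> (1 / real N) \<sigma>)\<^sup>2 =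
      demand_variance \<gamma> \<alpha> \<kappa> \<Gamma> (1 / real N) \<sigma> / demand_variance \<gamma> \<alpha> \<kappa> \<Gamma>' (1 / real N) \<sigma>"
    using eventually_ge_at_top[of 1]
  proof eventually_elim
    case (elim N)
    \<comment> \<open>At \<sigma> = 0 the common numerator is just 1/N; it is still nonzero at
      finite N, which is what permits cancelling it.\<close>
    then have "0 < 1 / real N" "0 \<le> (1 - 1 / real N) * \<sigma>"
      using assms by simp_all
    then have "1 / real N + (1 - 1 / real N) * \<sigma> \<noteq> 0"
      by linarith
    then show ?case
      by (simp add: demand_variance_def power_divide)
  qed
qed

section \<open>Comparison of the behavior models for large N\<close>

theorem corollary3:
  fixes \<gamma> \<alpha> \<kappa> gbar \<omega>bar :: real
    and M :: "nat \<Rightarrow> real \<Rightarrow> 'a measure"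
    and g :: "nat \<Rightarrow> real \<Rightarrow> nat \<Rightarrow> 'a \<Rightarrow> real"
    and V :: "behavior \<Rightarrow> nat \<Rightarrow> real \<Rightarrow> real"
  assumes "\<gamma> > 0" and "\<alpha> > 0" and "\<kappa> > 0" and "gbar > 0"
    and prefs: "\<And>N \<sigma>. N \<ge> 1 \<Longrightarrow> \<sigma> \<in> {0..1} \<Longrightarrow> correlated_preferences (M N \<sigma>) N gbar \<sigma> (g N \<sigma>)"
  defines "V \<equiv> \<lambda>\<Gamma> N \<sigma>. var_demand \<gamma> \<alpha> \<kappa> gbar \<omega>bar (M N \<sigma>) (g N \<sigma>) \<Gamma> N \<sigma>"
  shows
    "(\<forall>\<Gamma>. \<forall>\<sigma>\<in>{0..1}.
        (\<lambda>N. V \<Gamma> N \<sigma> - \<sigma> / (real N * lam \<gamma> \<kappa> \<Gamma> N * \<sigma> + 2 * \<alpha>) ^ 2) \<longlonglongrightarrow> 0 \<and>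
        (\<sigma> > 0 \<longrightarrow> (\<lambda>N. V \<Gamma> N \<sigma>) \<sim>[sequentially]
           (\<lambda>N. \<sigma> / (real N * lam \<gamma> \<kappa> \<Gamma> N * \<sigma> + 2 * \<alpha>) ^ 2)))
     \<and> (\<forall>\<Gamma>. \<forall>\<sigma>\<in>{0..1}.
        (\<exists>D. (\<forall>N\<ge>1. (V \<Gamma> N has_real_derivative D N) (at \<sigma> within {0..1})) \<and>
          (\<lambda>N. D N - (2 * \<alpha> - real N * lam \<gamma> \<kappa> \<Gamma> N * \<sigma>)
                   / (real N * lam \<gamma> \<kappa> \<Gamma> N * \<sigma> + 2 * \<alpha>) ^ 3) \<longlonglongrightarrow> 0) \<and>
        (\<forall>N\<ge>1. ((\<lambda>t. t / (real N * lam \<gamma> \<kappa> \<Gamma> N * t + 2 * \<alpha>) ^ 2) has_real_derivative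
            (2 * \<alpha> - real N * lam \<gamma> \<kappa> \<Gamma> N * \<sigma>) / (real N * lam \<gamma> \<kappa> \<Gamma> N * \<sigma> + 2 * \<alpha>) ^ 3)
          (at \<sigma> within {0..1})))
     \<and> (\<forall>\<Gamma> \<Gamma>'. (\<lambda>N. V \<Gamma> N 0) \<sim>[sequentially] (\<lambda>N. V \<Gamma>' N 0))
     \<and> (\<forall>\<sigma>\<in>{0<..1}.
        (\<forall>\<^sub>F N in sequentially.
           1 < V Selfish N \<sigma> / V Altruistic N \<sigma> \<and> V Selfish N \<sigma> / V Altruistic N \<sigma> < 4) \<and>
        (\<exists>r. (\<lambda>N. V Selfish N \<sigma> / V Altruistic N \<sigma>) \<longlonglongrightarrow> r \<and> 1 < r \<and> r < 4))
     \<and> (\<forall>\<sigma>\<in>{0<..1}.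
        (\<lambda>N. V Altruistic N \<sigma> / V Welfare N \<sigma>) \<longlonglongrightarrow> (\<alpha> + \<kappa> * \<sigma>) ^ 2 / (\<alpha> + \<gamma> * \<sigma>) ^ 2 \<and>
        (\<gamma> > \<kappa> \<longrightarrow>
           (\<alpha> + \<kappa> * \<sigma>) ^ 2 / (\<alpha> + \<gamma> * \<sigma>) ^ 2 < 1 \<and>
           (\<forall>\<^sub>F N in sequentially. V Altruistic N \<sigma> / V Welfare N \<sigma> < 1)))"
proof -
  note pos = \<open>\<gamma> > 0\<close> \<open>\<alpha> > 0\<close> \<open>\<kappa> > 0\<close>
  let ?F = "\<lambda>\<Gamma> N. demand_variance \<gamma> \<alpha> \<kappa> \<Gamma> (1 / real N)"
  \<comment> \<open>The probability spaces for different \<sigma> need not be related, yet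
    \<open>V\<close> depends on them only through this formula. This makes differentiation in
    \<sigma> meaningful.\<close>
  have V: "V \<Gamma> N \<sigma> = ?F \<Gamma> N \<sigma>" if "N \<ge> 1" "\<sigma> \<in> {0..1}" for \<Gamma> N \<sigma>
    using that pos \<open>gbar > 0\<close> prefs[OF that] by (simp add: V_def var_demand_eq_demand_variance)
  \<comment> \<open>The formulas hold only from N = 1 on, since N = 0 would divide by zero; limits
    ignore that term.\<close>
  have tendsto_cong: "X \<longlonglongrightarrow> l" if "Y \<longlonglongrightarrow> l" "\<And>N. N \<ge> 1 \<Longrightarrow> X N = Y N"
    for X Y :: "nat \<Rightarrow> real" and l
    using that(1) by (rule Lim_transform_eventually)
      (use that(2) in \<open>auto intro: eventually_mono[OF eventually_ge_at_top[of 1]]\<close>)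
  have c: "0 < lam \<gamma> \<kappa> \<Gamma> 1" for \<Gamma>
    using pos by (cases \<Gamma>) auto
  have denom: "0 < lam \<gamma> \<kappa> \<Gamma> 1 * \<sigma> + 2 * \<alpha>" if "0 \<le> \<sigma>" for \<Gamma> \<sigma>
    using pos c[of \<Gamma>] that by (simp add: add_nonneg_pos)
  have ratio: "(\<lambda>N. V \<Gamma> N \<sigma> / V \<Gamma>' N \<sigma>)
      \<longlonglongrightarrow> ((lam \<gamma> \<kappa> \<Gamma>' 1 * \<sigma> + 2 * \<alpha>) / (lam \<gamma> \<kappa> \<Gamma> 1 * \<sigma> + 2 * \<alpha>))\<^sup>2"
    if "\<sigma> \<in> {0..1}" for \<Gamma> \<Gamma>' \<sigma>
    by (rule tendsto_cong[OF demand_variance_ratio_tendsto]) (use that pos V in auto)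
  have lim: "(\<lambda>N. V \<Gamma> N \<sigma>) \<longlonglongrightarrow> \<sigma> / (lam \<gamma> \<kappa> \<Gamma> 1 * \<sigma> + 2 * \<alpha>)\<^sup>2" if "\<sigma> \<in> {0..1}" for \<Gamma> \<sigma>
    by (rule tendsto_cong[OF demand_variance_tendsto]) (use that pos V in auto)

  have part1a: "(\<lambda>N. V \<Gamma> N \<sigma> - \<sigma> / (real N * lam \<gamma> \<kappa> \<Gamma> N * \<sigma> + 2 * \<alpha>) ^ 2) \<longlonglongrightarrow> 0"
    if "\<sigma> \<in> {0..1}" for \<Gamma> \<sigma>
    by (rule tendsto_cong[OF LIM_zero[OF lim[OF that, of \<Gamma>]]]) (simp add: lam_scaled)
  have part1b: "(\<lambda>N. V \<Gamma> N \<sigma>) \<sim>[sequentially]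
      (\<lambda>N. \<sigma> / (real N * lam \<gamma> \<kappa> \<Gamma> N * \<sigma> + 2 * \<alpha>) ^ 2)" if "\<sigma> \<in> {0..1}" "\<sigma> > 0" for \<Gamma> \<sigma>
  proof (rule asymp_equivI')
    \<comment> \<open>Positivity of \<sigma> makes the limit nonzero, so convergence to it becomes
      convergence of the quotient to 1.\<close>
    have nz: "\<sigma> / (lam \<gamma> \<kappa> \<Gamma> 1 * \<sigma> + 2 * \<alpha>)\<^sup>2 \<noteq> 0"
      using denom[of \<sigma> \<Gamma>] that by simp
    have "(\<lambda>N. V \<Gamma> N \<sigma> / (\<sigma> / (lam \<gamma> \<kappa> \<Gamma> 1 * \<sigma> + 2 * \<alpha>)\<^sup>2)) \<longlonglongrightarrow> 1"
      using tendsto_divide[OF lim[OF that(1), of \<Gamma>] tendsto_const nz]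
      unfolding divide_self[OF nz] .
    then show "(\<lambda>N. V \<Gamma> N \<sigma> / (\<sigma> / (real N * lam \<gamma> \<kappa> \<Gamma> N * \<sigma> + 2 * \<alpha>) ^ 2)) \<longlonglongrightarrow> 1"
      by (rule tendsto_cong) (simp add: lam_scaled)
  qed

  have part2a: "\<exists>D. (\<forall>N\<ge>1. (V \<Gamma> N has_real_derivative D N) (at \<sigma> within {0..1})) \<and>
      (\<lambda>N. D N - (2 * \<alpha> - real N * lam \<gamma> \<kappa> \<Gamma> N * \<sigma>)
        / (real N * lam \<gamma> \<kappa> \<Gamma> N * \<sigma> + 2 * \<alpha>) ^ 3) \<longlonglongrightarrow> 0"
    if \<sigma>: "\<sigma> \<in> {0..1}" for \<Gamma> \<sigma>
  proof (intro exI conjI allI impI)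
    let ?D = "\<lambda>N. demand_variance_deriv \<gamma> \<alpha> \<kappa> \<Gamma> (1 / real N) \<sigma>"
    \<comment> \<open>\<open>V\<close> and the rational function agree on all of [0,1], so the
      derivative within this interval carries over.\<close>
    show "(V \<Gamma> N has_real_derivative ?D N) (at \<sigma> within {0..1})" if "N \<ge> 1" for N
    proof (rule has_field_derivative_transform_within[OF _ zero_less_one \<sigma>])
      show "(?F \<Gamma> N has_real_derivative ?D N) (at \<sigma> within {0..1})"
        using pos \<sigma> that by (intro demand_variance_has_derivative) auto
    qed (simp add: V[OF that])
    have "?D \<longlonglongrightarrow> (2 * \<alpha> - lam \<gamma> \<kappa> \<Gamma> 1 * \<sigma>) / (lam \<gamma> \<kappa> \<Gamma> 1 * \<sigma> + 2 * \<alpha>) ^ 3"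
      using pos \<sigma> by (intro demand_variance_deriv_tendsto) auto
    from LIM_zero[OF this] show "(\<lambda>N. ?D N - (2 * \<alpha> - real N * lam \<gamma> \<kappa> \<Gamma> N * \<sigma>)
        / (real N * lam \<gamma> \<kappa> \<Gamma> N * \<sigma> + 2 * \<alpha>) ^ 3) \<longlonglongrightarrow> 0"
      by (rule tendsto_cong) (simp add: lam_scaled)
  qed
  \<comment> \<open>The approximation is exactly \<open>demand_variance\<close> at h = 0, so the
    same derivative lemma applies.\<close>
  have part2b: "((\<lambda>t. t / (real N * lam \<gamma> \<kappa> \<Gamma> N * t + 2 * \<alpha>) ^ 2) has_real_derivative
      (2 * \<alpha> - real N * lam \<gamma> \<kappa> \<Gamma> N * \<sigma>) / (real N * lam \<gamma> \<kappa> \<Gamma> N * \<sigma> + 2 * \<alpha>) ^ 3)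
      (at \<sigma> within {0..1})" if "\<sigma> \<in> {0..1}" "N \<ge> 1" for \<Gamma> \<sigma> N
    using demand_variance_has_derivative[OF pos, of 0 \<sigma> \<Gamma> "{0..1}"] that
    by (simp add: demand_variance_def[abs_def] demand_variance_deriv_def inv_a_0 lam_scaled mult.commute)

  \<comment> \<open>At \<sigma> = 0 both limiting denominators are 2\<alpha>, so the ratio tends to
    1.\<close>
  have part3: "(\<lambda>N. V \<Gamma> N 0) \<sim>[sequentially] (\<lambda>N. V \<Gamma>' N 0)" for \<Gamma> \<Gamma>'
    using ratio[of 0 \<Gamma> \<Gamma>'] pos by (intro asymp_equivI') simp

  have part4: "(\<forall>\<^sub>F N in sequentially.
        1 < V Selfish N \<sigma> / V Altruistic N \<sigma> \<and> V Selfish N \<sigma> / V Altruistic N \<sigma> < 4) \<and>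
      (\<exists>r. (\<lambda>N. V Selfish N \<sigma> / V Altruistic N \<sigma>) \<longlonglongrightarrow> r \<and> 1 < r \<and> r < 4)"
    if \<sigma>: "\<sigma> \<in> {0<..1}" for \<sigma>
  proof -
    \<comment> \<open>The quotient of the limiting denominators, altruistic over selfish. It exceeds
      1 because \<gamma>\<sigma> > 0 and stays below 2 because 2\<alpha> < 4\<alpha>.\<close>
    define q where "q = (2 * \<gamma> * \<sigma> + 2 * \<alpha>) / (\<gamma> * \<sigma> + 2 * \<alpha>)"
    have q: "1 < q" "q < 2"
      using pos \<sigma> by (simp_all add: q_def add_pos_pos divide_simps)
    then have "1 < q\<^sup>2" "q\<^sup>2 < 4"
      using power_strict_mono[of q 2 2] by (simp_all add: one_less_power)
    moreover have lim_q: "(\<lambda>N. V Selfish N \<sigma> / V Altruistic N \<sigma>) \<longlonglongrightarrow> q\<^sup>2"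
      using ratio[of \<sigma> Selfish Altruistic] \<sigma> by (simp add: q_def)
    \<comment> \<open>The limit lies strictly between 1 and 4, so the exact ratios do so
      eventually.\<close>
    ultimately show ?thesis
      by (auto intro!: exI[of _ "q\<^sup>2"] eventually_conj order_tendstoD[OF lim_q])
  qed

  have part5a: "(\<lambda>N. V Altruistic N \<sigma> / V Welfare N \<sigma>)
      \<longlonglongrightarrow> (\<alpha> + \<kappa> * \<sigma>) ^ 2 / (\<alpha> + \<gamma> * \<sigma>) ^ 2" if "\<sigma> \<in> {0<..1}" for \<sigma>
  proof -
    \<comment> \<open>The constants c are 2\<kappa> and 2\<gamma> here, so a common factor 2
      cancels.\<close>
    have "(2 * \<kappa> * \<sigma> + 2 * \<alpha>) / (2 * \<gamma> * \<sigma> + 2 * \<alpha>)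
        = (2 * (\<alpha> + \<kappa> * \<sigma>)) / (2 * (\<alpha> + \<gamma> * \<sigma>))"
      by (simp add: algebra_simps)
    also have "\<dots> = (\<alpha> + \<kappa> * \<sigma>) / (\<alpha> + \<gamma> * \<sigma>)"
      by (rule mult_divide_mult_cancel_left) simp
    finally show ?thesis
      using ratio[of \<sigma> Altruistic Welfare] that by (simp add: power_divide)
  qed
  have part5b: "(\<alpha> + \<kappa> * \<sigma>) ^ 2 / (\<alpha> + \<gamma> * \<sigma>) ^ 2 < 1" if "\<sigma> \<in> {0<..1}" "\<gamma> > \<kappa>" for \<sigma>
  proof -
    have "0 < \<alpha> + \<kappa> * \<sigma>" "\<alpha> + \<kappa> * \<sigma> < \<alpha> + \<gamma> * \<sigma>"
      using pos that by (simp_all add: add_pos_pos)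
    then show ?thesis
      using power_strict_mono[of "\<alpha> + \<kappa> * \<sigma>" "\<alpha> + \<gamma> * \<sigma>" 2] by simp
  qed

  \<comment> \<open>The remaining eventual bound by 1 in the last claim follows from the strict
    bound on the limit.\<close>
  show ?thesis
    using part1a part1b part2a part2b part3 part4 part5a part5b order_tendstoD(2)[OF part5a part5b]
    by (intro conjI allI ballI impI) blast+
qed

end
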